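(* Assume that $n(m) < \infty$ for every positive integer $m$. Let $N \geq 2$ be an integer and let $z_N \in \mathbb{C}$ be any root of the Collatz polynomial $P_N(z)$. Then equality holds in the inequality $$\frac{2\, M(N)}{3\, M(N) + 1} \leq |z_N|$$ if and only if $N$ is a power of $2$.
   Context: For a non-negative integer $N$ define $c(N) = N/2$ if $N$ is even, $c(N) = (3N+1)/2$ if $N$ is odd and $N \neq 1$, and $c(1) = 0$. Put $c^0(N) = N$ and $c^j(N) = c(c^{j-1}(N))$ for $j \geq 1$; the numbers $c^j(N)$, $j \geq 0$, are the Collatz iterates of $N$ (so $N$ itself is an iterate). Let $n(N) = \min\{ j \geq 0 : c^j(N) = 1\}$ (with $n(N)=\infty$ if there is no such $j$). Standing assumption: $n(N) < \infty$ for all positive integers $N$. The $N$th Collatz polynomial is $P_N(z) = \sum_{j=0}^{n(N)} c^j(N)\, z^j$. The number $M(N)$ is the least odd Collatz iterate of $N$ that is greater than $1$ if such an iterate exists, and $M(N) := -1/2$ otherwise (in which case $\frac{2M(N)}{3M(N)+1} = 2$). *)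

theory Defs
  imports Complex_Main "HOL-Library.Extended_Nat" "HOL-Computational_Algebra.Polynomial"
begin

text \<open>Both divisions are exact. In contrast to the usual Collatz map, \<open>1\<close> is sent to \<open>0\<close>.\<close>

definition collatz :: "nat \<Rightarrow> nat" where
  "collatz N =
     (if even N then N div 2 else if N = 1 then 0 else (3 * N + 1) div 2)"

definition collatz_iterate :: "nat \<Rightarrow> nat \<Rightarrow> nat" where
  "collatz_iterate j N = (collatz ^^ j) N"

text \<open>The infimum of the empty set is \<open>\<infinity>\<close>; otherwise it is the minimum.\<close>

definition collatz_time :: "nat \<Rightarrow> enat" where
  "collatz_time N = (INF j \<in> {j. collatz_iterate j N = 1}. enat j)"

text \<open>Only meaningful if \<^term>\<open>collatz_time N\<close> is finite.\<close>

definition collatz_poly :: "nat \<Rightarrow> complex poly" where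
  "collatz_poly N =
     (\<Sum>j \<le> the_enat (collatz_time N). monom (of_nat (collatz_iterate j N)) j)"

definition odd_iterates_gt_1 :: "nat \<Rightarrow> nat set" where
  "odd_iterates_gt_1 N = {m. odd m \<and> m > 1 \<and> (\<exists>j. m = collatz_iterate j N)}"

definition collatz_M :: "nat \<Rightarrow> real" where
  "collatz_M N =
     (if odd_iterates_gt_1 N \<noteq> {} then real (LEAST m. m \<in> odd_iterates_gt_1 N) else - 1 / 2)"

end

theory Submission imports Defs begin

text \<open>
  The coefficients \<open>a\<^sub>0, \<dots>, a\<^sub>n\<close> of the Collatz polynomial of \<open>N\<close> are positive and
  \<open>a\<^sub>n = 1\<close>. The ratio \<open>a\<^sub>j / a\<^sub>j\<^sub>+\<^sub>1\<close> is \<open>2\<close> if \<open>a\<^sub>j\<close> is even, and \<open>2 m / (3 m + 1)\<close>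
  if \<open>a\<^sub>j = m\<close> is odd. The latter increases with \<open>m\<close>.

  If no odd iterate exceeds \<open>1\<close>, then every ratio is \<open>2\<close>. This happens exactly when
  \<open>N = 2\<^sup>n\<close> (lemma \<open>no_odd_iterates_iff_power_of_two\<close>). The polynomial is then
  \<open>(z\<^sup>n\<^sup>+\<^sup>1 - 2\<^sup>n\<^sup>+\<^sup>1) / (z - 2)\<close>, so all its roots have modulus \<open>2\<close>, which is the
  value of the bound for \<open>M = - 1/2\<close>.

  Otherwise put \<open>r = 2 M / (3 M + 1)\<close>. Every ratio is at least \<open>r\<close>, so the numbers
  \<open>b\<^sub>j = a\<^sub>j r\<^sup>j\<close> decrease weakly: the hypothesis of the Enestroem-Kakeya theorem for
  the polynomial rescaled by \<open>r\<close>. A root \<open>z\<close> of modulus \<open>r\<close> would give a root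
  \<open>w = z / r\<close> on the unit circle of the polynomial with coefficients \<open>b\<^sub>j\<close>, that is, the
  equality case of the triangle inequality behind that theorem. Equality forces
  \<open>w\<^sup>j = 1\<close> for every \<open>j \<ge> 1\<close> with \<open>b\<^sub>j\<^sub>-\<^sub>1 > b\<^sub>j\<close>, and also \<open>w\<^sup>n\<^sup>+\<^sup>1 = 1\<close> because
  \<open>b\<^sub>n > 0\<close>. The step before \<open>1\<close> in a Collatz trajectory starts at \<open>2\<close>, so its ratio
  is \<open>2 > r\<close> and \<open>w\<^sup>n = 1\<close> holds as well. Thus \<open>w = 1\<close>, but a polynomial with
  positive coefficients does not vanish at \<open>1\<close>
  (lemma \<open>no_root_on_unit_circle_if_decreasing\<close>).
\<close>

section \<open>Polynomials with decreasing coefficients\<close>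

lemma Re_eq_1_imp_eq_1:
  assumes "cmod u = 1" "Re u = 1"
  shows "u = 1"
  using assms cmod_power2[of u] by (simp add: complex_eq_iff)

text \<open>
  This is the boundary case of the Enestroem-Kakeya theorem. Multiplying by \<open>1 - w\<close> turns
  \<open>\<Sum>j\<le>n. b\<^sub>j w\<^sup>j = 0\<close> into an equation between the real number \<open>b\<^sub>0\<close> and a combination
  of powers of \<open>w\<close> whose nonnegative weights, the differences of consecutive
  coefficients and \<open>b\<^sub>n\<close>, add up to \<open>b\<^sub>0\<close>. Hence every power with positive weight has real
  part \<open>1\<close>, so equals \<open>1\<close>. The strict last step supplies two consecutive exponents.
\<close>

lemma no_root_on_unit_circle_if_decreasing:
  fixes b :: "nat \<Rightarrow> real" and w :: complex
  assumes decr: "\<And>j. j \<le> n \<Longrightarrow> b (Suc j) \<le> b j"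
    and strict: "b (Suc n) < b n"
    and pos: "\<And>j. j \<le> Suc n \<Longrightarrow> 0 < b j"
    and w: "cmod w = 1"
  shows "(\<Sum>j\<le>Suc n. of_real (b j) * w ^ j) \<noteq> 0"
proof
  assume root: "(\<Sum>j\<le>Suc n. of_real (b j) * w ^ j) = 0"
  have telescope: "(1 - w) * (\<Sum>j\<le>m. of_real (b j) * w ^ j) =
      of_real (b 0) - (\<Sum>j<m. of_real (b j - b (Suc j)) * w ^ Suc j)
      - of_real (b m) * w ^ Suc m" for m
    by (induction m) (simp_all add: algebra_simps)
  have "of_real (b 0) - (\<Sum>j<Suc n. of_real (b j - b (Suc j)) * w ^ Suc j)
      - of_real (b (Suc n)) * w ^ Suc (Suc n) = 0"
    using telescope[of "Suc n"] root by simp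
  then have "b 0 - (\<Sum>j<Suc n. (b j - b (Suc j)) * Re (w ^ Suc j))
      - b (Suc n) * Re (w ^ Suc (Suc n)) = 0"
    by (drule_tac arg_cong[where f = Re])
      (simp del: of_real_diff power_Suc sum.lessThan_Suc)
  moreover have "b 0 = (\<Sum>j<Suc n. b j - b (Suc j)) + b (Suc n)"
    by (simp only: sum_lessThan_telescope')
  ultimately have weighted_sum: "(\<Sum>j<Suc n. (b j - b (Suc j)) * (1 - Re (w ^ Suc j)))
      + b (Suc n) * (1 - Re (w ^ Suc (Suc n))) = 0"
    by (simp only: right_diff_distrib sum_subtractf mult_1_right)
  have Re_le: "Re (w ^ k) \<le> 1" for k
    using complex_Re_le_cmod[of "w ^ k"] w by (simp add: norm_power)
  have terms: "0 \<le> (b j - b (Suc j)) * (1 - Re (w ^ Suc j))" if "j < Suc n" for j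
    using decr[of j] Re_le[of "Suc j"] that by (intro mult_nonneg_nonneg) auto
  have "0 \<le> (\<Sum>j<Suc n. (b j - b (Suc j)) * (1 - Re (w ^ Suc j)))"
    using terms by (intro sum_nonneg) auto
  moreover have "0 \<le> b (Suc n) * (1 - Re (w ^ Suc (Suc n)))"
    using pos[of "Suc n"] Re_le[of "Suc (Suc n)"] by (intro mult_nonneg_nonneg) auto
  ultimately have sum0: "(\<Sum>j<Suc n. (b j - b (Suc j)) * (1 - Re (w ^ Suc j))) = 0"
    and last0: "b (Suc n) * (1 - Re (w ^ Suc (Suc n))) = 0"
    using weighted_sum by linarith+
  have "(b n - b (Suc n)) * (1 - Re (w ^ Suc n)) = 0"
    using sum0 terms
    by (subst (asm) sum_nonneg_eq_0_iff) (auto simp del: power_Suc)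
  then have "w ^ Suc n = 1"
    using strict w by (intro Re_eq_1_imp_eq_1) (simp_all add: norm_power norm_mult)
  moreover have "w ^ Suc (Suc n) = 1"
    using last0 pos[of "Suc n"] w
    by (intro Re_eq_1_imp_eq_1) (simp_all add: norm_power norm_mult)
  ultimately have "w = 1"
    by (metis mult.right_neutral power_Suc)
  then have "of_real (\<Sum>j\<le>Suc n. b j) = (0 :: complex)"
    using root by simp
  then have "(\<Sum>j\<le>Suc n. b j) = 0"
    by (simp only: of_real_eq_0_iff)
  moreover have "0 < (\<Sum>j\<le>Suc n. b j)"
    using pos by (intro sum_pos) auto
  ultimately show False by simp
qed

section \<open>Collatz trajectories\<close>

lemma collatz_iterate_0: "collatz_iterate 0 N = N"
  by (simp add: collatz_iterate_def)

lemma collatz_iterate_Suc: "collatz_iterate (Suc j) N = collatz (collatz_iterate j N)"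
  by (simp add: collatz_iterate_def)

lemma collatz_eq_1_iff: "collatz a = 1 \<longleftrightarrow> a = 2"
  by (cases "a = 0") (auto simp: collatz_def elim!: evenE oddE)

lemma collatz_time_finiteE:
  assumes "collatz_time N < \<infinity>"
  obtains n where "collatz_time N = enat n" "collatz_iterate n N = 1"
    "\<And>j. j < n \<Longrightarrow> collatz_iterate j N \<noteq> 1"
proof -
  define S where "S = enat ` {j. collatz_iterate j N = 1}"
  have "S \<noteq> {}"
    using assms unfolding collatz_time_def S_def[symmetric]
    by (auto simp: top_enat_def)
  then have "collatz_time N \<in> S"
    unfolding collatz_time_def S_def[symmetric] Inf_enat_def
    by (metis LeastI ex_in_conv)
  then obtain n where n: "collatz_time N = enat n" "collatz_iterate n N = 1"
    by (auto simp: S_def)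
  have "collatz_iterate j N \<noteq> 1" if "j < n" for j
  proof
    assume "collatz_iterate j N = 1"
    then have "collatz_time N \<le> enat j"
      unfolding collatz_time_def by (intro INF_lower) simp
    with n that show False by simp
  qed
  with n that show thesis by blast
qed

lemma collatz_iterate_gt_1:
  assumes "N \<ge> 1" "\<And>j. j < n \<Longrightarrow> collatz_iterate j N \<noteq> 1" "j < n"
  shows "1 < collatz_iterate j N"
  using assms(3)
proof (induction j)
  case 0
  then show ?case using assms(1) assms(2)[of 0] by (simp add: collatz_iterate_0)
next
  case (Suc j)
  then have "1 < collatz_iterate j N" by simp
  then have "0 < collatz_iterate (Suc j) N"
    by (auto simp: collatz_iterate_Suc collatz_def elim!: evenE)
  with assms(2)[OF Suc.prems] show ?case by linarith
qed

lemma collatz_iterate_all_even: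
  assumes "\<And>j. j < n \<Longrightarrow> even (collatz_iterate j N)" "j \<le> n"
  shows "N = 2 ^ j * collatz_iterate j N"
  using assms(2)
proof (induction j)
  case 0
  then show ?case by (simp add: collatz_iterate_0)
next
  case (Suc j)
  then have "even (collatz_iterate j N)" using assms(1) by simp
  then have "collatz_iterate j N = 2 * collatz_iterate (Suc j) N"
    by (simp add: collatz_iterate_Suc collatz_def)
  with Suc show ?case by simp
qed

lemma collatz_iterate_power_of_two:
  "collatz_iterate j (2 ^ k) = (if j \<le> k then 2 ^ (k - j) else 0)"
proof (induction j)
  case 0
  then show ?case by (simp add: collatz_iterate_0)
next
  case (Suc j)
  show ?case
  proof (cases "j < k")
    case True
    then have "k - j = Suc (k - Suc j)" by simp
    with Suc True show ?thesis by (simp add: collatz_iterate_Suc collatz_def)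
  next
    case False
    with Suc show ?thesis by (cases "j = k") (auto simp: collatz_iterate_Suc collatz_def)
  qed
qed

lemma no_odd_iterates_iff_power_of_two:
  assumes "N \<ge> 1" "collatz_time N < \<infinity>"
  shows "odd_iterates_gt_1 N = {} \<longleftrightarrow> (\<exists>k. N = 2 ^ k)"
proof
  assume empty: "odd_iterates_gt_1 N = {}"
  obtain n where n: "collatz_iterate n N = 1"
    "\<And>j. j < n \<Longrightarrow> collatz_iterate j N \<noteq> 1"
    using collatz_time_finiteE[OF assms(2)] by metis
  have "even (collatz_iterate j N)" if "j < n" for j
    using empty collatz_iterate_gt_1[OF assms(1) n(2) that]
    by (auto simp: odd_iterates_gt_1_def)
  then show "\<exists>k. N = 2 ^ k"
    using collatz_iterate_all_even[of n N n] n(1) by auto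
next
  assume "\<exists>k. N = 2 ^ k"
  then show "odd_iterates_gt_1 N = {}"
    by (auto simp: odd_iterates_gt_1_def collatz_iterate_power_of_two split: if_splits)
qed

section \<open>Roots of Collatz polynomials\<close>

lemma poly_collatz_poly:
  assumes "collatz_time N = enat n"
  shows "poly (collatz_poly N) z = (\<Sum>j\<le>n. of_nat (collatz_iterate j N) * z ^ j)"
  using assms by (simp add: collatz_poly_def poly_sum poly_monom)

lemma cmod_root_collatz_poly_power_of_two:
  assumes "collatz_time (2 ^ k) < \<infinity>" "poly (collatz_poly (2 ^ k)) z = 0"
  shows "cmod z = 2"
proof -
  obtain n where n: "collatz_time (2 ^ k) = enat n" "collatz_iterate n (2 ^ k) = 1"
    using collatz_time_finiteE[OF assms(1)] by metis
  from n(2) have "n = k"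
    by (auto simp: collatz_iterate_power_of_two split: if_splits)
  then have "(\<Sum>j\<le>k. z ^ j * 2 ^ (k - j)) = 0"
    using assms(2) n(1)
    by (simp add: poly_collatz_poly collatz_iterate_power_of_two mult.commute)
  then have "z ^ Suc k - 2 ^ Suc k = 0"
    using diff_power_eq_sum[of z k 2]
    by (simp add: lessThan_Suc_atMost del: power_Suc)
  then have "z ^ Suc k = 2 ^ Suc k"
    by (simp only: right_minus_eq)
  then have "cmod z ^ Suc k = 2 ^ Suc k"
    by (metis norm_power norm_numeral)
  then show ?thesis
    by (rule power_eq_imp_eq_base) auto
qed

text \<open>
  At an even iterate the ratio of consecutive iterates is \<open>2\<close>, and \<open>2 M / (3 M + 1) < 2/3\<close>;
  at an odd iterate \<open>a\<close> the claim amounts to \<open>M \<le> a\<close>.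
\<close>

lemma collatz_ratio_bound:
  fixes M :: real
  assumes "1 < a" "0 < M" "odd a \<Longrightarrow> M \<le> real a"
  shows "2 * M / (3 * M + 1) * real (collatz a) \<le> real a"
proof (cases "even a")
  case True
  then obtain c where c: "a = 2 * c" by blast
  then have "collatz a = c" by (simp add: collatz_def)
  moreover have "2 * M * c \<le> 2 * c * (3 * M + 1)"
    using assms(2) by (simp add: algebra_simps)
  ultimately show ?thesis
    using c assms(2) by (simp add: field_simps)
next
  case False
  then obtain c where c: "a = 2 * c + 1" by (elim oddE)
  with False assms(1) have "real (collatz a) = (3 * real a + 1) / 2"
    by (simp add: collatz_def)
  moreover have "M * (3 * real a + 1) \<le> real a * (3 * M + 1)"
    using assms(3)[OF False] by (simp add: algebra_simps)
  ultimately show ?thesis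
    using assms(2) by (simp add: field_simps)
qed

lemma cmod_root_collatz_poly_neq:
  fixes z :: complex
  assumes "N \<ge> 2" "collatz_time N < \<infinity>" "poly (collatz_poly N) z = 0"
    and odd: "odd_iterates_gt_1 N \<noteq> {}"
  shows "cmod z \<noteq> 2 * collatz_M N / (3 * collatz_M N + 1)"
proof
  define M where "M = collatz_M N"
  define r where "r = 2 * M / (3 * M + 1)"
  assume "cmod z = 2 * collatz_M N / (3 * collatz_M N + 1)"
  then have z: "cmod z = r" by (simp add: r_def M_def)
  obtain n0 where n0: "collatz_time N = enat n0" "collatz_iterate n0 N = 1"
    "\<And>j. j < n0 \<Longrightarrow> collatz_iterate j N \<noteq> 1"
    using collatz_time_finiteE[OF assms(2)] by metis
  from n0(2) assms(1) obtain n where n: "n0 = Suc n"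
    by (cases n0) (auto simp: collatz_iterate_0)
  have gt1: "1 < collatz_iterate j N" if "j \<le> n" for j
    using collatz_iterate_gt_1[of N n0 j] assms(1) n0(3) n that by simp
  have M_eq: "M = real (LEAST m. m \<in> odd_iterates_gt_1 N)"
    using odd by (simp add: M_def collatz_M_def)
  have "(LEAST m. m \<in> odd_iterates_gt_1 N) \<in> odd_iterates_gt_1 N"
    using odd by (auto intro: LeastI)
  then have "M > 1"
    by (simp add: M_eq odd_iterates_gt_1_def)
  then have r: "0 < r" "r < 1"
    by (simp_all add: r_def field_simps)
  have M_le: "M \<le> real (collatz_iterate j N)" if "j \<le> n" "odd (collatz_iterate j N)" for j
    unfolding M_eq using gt1[OF that(1)] that(2)
    by (auto simp: odd_iterates_gt_1_def intro: Least_le)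
  define b where "b = (\<lambda>j. real (collatz_iterate j N) * r ^ j)"
  have decr: "b (Suc j) \<le> b j" if "j \<le> n" for j
  proof -
    have "r * real (collatz_iterate (Suc j) N) \<le> real (collatz_iterate j N)"
      unfolding r_def collatz_iterate_Suc
      using gt1[OF that] M_le[OF that] \<open>M > 1\<close> by (intro collatz_ratio_bound) auto
    then have "r * real (collatz_iterate (Suc j) N) * r ^ j \<le> real (collatz_iterate j N) * r ^ j"
      using r by (intro mult_right_mono) auto
    then show ?thesis by (simp add: b_def mult_ac)
  qed
  have "collatz_iterate n N = 2"
    using n0(2) n by (simp only: collatz_iterate_Suc collatz_eq_1_iff)
  then have "b (Suc n) < b n"
    using n0(2) n r by (simp add: b_def)
  moreover have "0 < b j" if "j \<le> Suc n" for j
    using gt1[of j] n0(2) n r that by (cases "j = Suc n") (auto simp: b_def)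
  moreover have "cmod (z / of_real r) = 1"
    using z r by (simp add: norm_divide)
  ultimately have "(\<Sum>j\<le>Suc n. of_real (b j) * (z / of_real r) ^ j) \<noteq> 0"
    using decr by (intro no_root_on_unit_circle_if_decreasing)
  moreover have "of_real (b j) * (z / of_real r) ^ j = of_nat (collatz_iterate j N) * z ^ j" for j
    using r by (simp add: b_def power_divide)
  ultimately show False
    using assms(3) n0(1) n by (simp only: poly_collatz_poly)
qed

theorem theorem2:
  fixes N :: nat and z :: complex
  assumes "\<forall>m::nat. m > 0 \<longrightarrow> collatz_time m < \<infinity>"
    and "N \<ge> 2"
    and "poly (collatz_poly N) z = 0"
  shows "2 * collatz_M N / (3 * collatz_M N + 1) = cmod z \<longleftrightarrow> (\<exists>k::nat. N = 2 ^ k)"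
proof -
  have fin: "collatz_time N < \<infinity>"
    using assms(1,2) by simp
  have iff: "odd_iterates_gt_1 N = {} \<longleftrightarrow> (\<exists>k. N = 2 ^ k)"
    using no_odd_iterates_iff_power_of_two[OF _ fin] assms(2) by simp
  show ?thesis
  proof (cases "odd_iterates_gt_1 N = {}")
    case True
    with iff obtain k where "N = 2 ^ k" by blast
    then have "cmod z = 2"
      using cmod_root_collatz_poly_power_of_two fin assms(3) by blast
    moreover have "collatz_M N = - 1 / 2"
      using True by (simp add: collatz_M_def)
    ultimately show ?thesis
      using True iff by simp
  next
    case False
    with iff cmod_root_collatz_poly_neq[OF assms(2) fin assms(3)] show ?thesis
      by auto
  qed
qed

end
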